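(* Let $G$ be a connected graph with vertex set $\{v_{1},\ldots,v_{n}\}$ and edge set $\{e_{1},\ldots,e_{m}\}$, and let $0\le\alpha\le1$. Let $\deg(e_{i})$ denote the number of edges of $G$ adjacent to $e_{i}$. Then $$\rho(L(G))\geq 2(m-1)-\frac{1}{m}\sum_{i=1}^{m}\deg(e_{i}).$$
   Context: Two distinct edges are adjacent if they share an endpoint. $L(G)$ is the line graph of $G$ (vertices are the edges of $G$, adjacent iff they share an endpoint). For a connected graph $H$, the generalized distance matrix is $\mathcal{D}_\alpha(H)=\alpha\,Tr(H)+(1-\alpha)\mathcal{D}(H)$, where $\mathcal{D}(H)$ is the distance matrix and $Tr(H)$ the diagonal matrix of vertex transmissions $Tr(u)=\sum_v d(u,v)$; $\rho(H)$ is its largest eigenvalue. *)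

theory Defs
  imports
    "Graph_Theory.Graph_Theory"
    "Jordan_Normal_Form.Spectral_Radius"
begin

text \<open>
  A finite simple undirected graph is a \<open>pair_graph\<close>: finite, loop-free, symmetric, without
  parallel arcs. Its undirected edge joining \<open>u\<close> and \<open>v\<close> is the set \<open>{u, v}\<close>, so the two
  arcs \<open>(u, v)\<close> and \<open>(v, u)\<close> count as one edge.
\<close>

definition edges :: "'a pair_pre_digraph \<Rightarrow> 'a set set" where
  "edges G = {{u, v} | u v. (u, v) \<in> parcs G}"

definition adjacent_edges :: "'a set \<Rightarrow> 'a set \<Rightarrow> bool" where
  "adjacent_edges e f \<longleftrightarrow> e \<noteq> f \<and> e \<inter> f \<noteq> {}"

definition edge_degree :: "'a pair_pre_digraph \<Rightarrow> 'a set \<Rightarrow> nat" where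
  "edge_degree G e = card {f \<in> edges G. adjacent_edges e f}"

definition line_graph :: "'a pair_pre_digraph \<Rightarrow> 'a set pair_pre_digraph" where
  "line_graph G = \<lparr> pverts = edges G,
     parcs = {(e, f). e \<in> edges G \<and> f \<in> edges G \<and> adjacent_edges e f} \<rparr>"

lemma pair_graph_line_graph:
  assumes "pair_graph G"
  shows "pair_graph (line_graph G)"
proof -
  interpret pair_graph G by fact
  have "edges G = (\<lambda>(u, v). {u, v}) ` parcs G"
    by (auto simp: edges_def image_iff)
  then have fin: "finite (edges G)"
    using pair_finite_arcs by simp
  have "parcs (line_graph G) \<subseteq> edges G \<times> edges G"
    by (auto simp: line_graph_def)
  then have "finite (parcs (line_graph G))"
    using fin by (meson finite_SigmaI finite_subset)
  then show ?thesis
    using fin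
    by unfold_locales
      (auto simp: line_graph_def adjacent_edges_def symmetric_def sym_def)
qed

text \<open>
  The distance is the least cost of a walk when every arc costs 1. It is a real number here; the
  value \<open>0\<close> that \<open>real_of_ereal\<close> gives to an infinite distance is only met between different
  components of a disconnected graph.
\<close>

definition graph_dist :: "'a pair_pre_digraph \<Rightarrow> 'a \<Rightarrow> 'a \<Rightarrow> real" where
  "graph_dist H u v = real_of_ereal (wf_digraph.\<mu> (with_proj H) (\<lambda>_. 1) u v)"

definition transmission :: "'a pair_pre_digraph \<Rightarrow> 'a \<Rightarrow> real" where
  "transmission H u = (\<Sum>v\<in>pverts H. graph_dist H u v)"

text \<open>
  The matrices of \<open>H\<close> are indexed by positions in a list \<open>vs\<close> that is meant to enumerate the
  vertices of \<open>H\<close> without repetition.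
\<close>

definition distance_matrix :: "'a pair_pre_digraph \<Rightarrow> 'a list \<Rightarrow> real mat" where
  "distance_matrix H vs =
     mat (length vs) (length vs) (\<lambda>(i, j). graph_dist H (vs ! i) (vs ! j))"

definition transmission_matrix :: "'a pair_pre_digraph \<Rightarrow> 'a list \<Rightarrow> real mat" where
  "transmission_matrix H vs = mat_diag (length vs) (\<lambda>i. transmission H (vs ! i))"

definition gen_distance_matrix :: "real \<Rightarrow> 'a pair_pre_digraph \<Rightarrow> 'a list \<Rightarrow> real mat" where
  "gen_distance_matrix \<alpha> H vs =
     \<alpha> \<cdot>\<^sub>m transmission_matrix H vs + (1 - \<alpha>) \<cdot>\<^sub>m distance_matrix H vs"

text \<open>
  The real spectrum is the whole spectrum in our use, as generalized distance matrices of graphs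
  are symmetric.
\<close>

definition largest_eigenvalue :: "real mat \<Rightarrow> real" where
  "largest_eigenvalue A = Max (spectrum A)"

definition gen_distance_rho :: "real \<Rightarrow> 'a pair_pre_digraph \<Rightarrow> 'a list \<Rightarrow> real" where
  "gen_distance_rho \<alpha> H vs = largest_eigenvalue (gen_distance_matrix \<alpha> H vs)"

end

theory Submission
  imports Defs "HOL-Analysis.Function_Topology"
begin

text \<open>
  By Rayleigh's principle, the largest eigenvalue of a symmetric matrix is at least the average of
  its row sums (take the all-ones vector). For every \<open>\<alpha>\<close>, the row sums of the generalized
  distance matrix are the transmissions. In the connected graph \<open>L(G)\<close> an edge \<open>e\<close> has distance 1
  to the \<open>deg(e)\<close> edges adjacent to it and at least 2 to the remaining \<open>m - 1 - deg(e)\<close> ones, so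
  its transmission is at least \<open>2 (m - 1) - deg(e)\<close>.
\<close>

section \<open>Rayleigh's principle for real symmetric matrices\<close>

text \<open>Vectors of length \<open>n\<close> are represented as functions that vanish from
  \<open>n\<close> on. The box is then a product of compact intervals, all but \<open>n\<close> of
  them \<open>{0}\<close>, and Tychonoff's theorem applies.\<close>

lemma compact_box_fun:
  "compact {x :: nat \<Rightarrow> real. \<forall>i. \<bar>x i\<bar> \<le> (if i < n then 1 else 0)}"
proof -
  let ?S = "\<lambda>i. if i < n then {-1..1::real} else {0}"
  have "compactin (product_topology (\<lambda>i::nat. euclidean) UNIV) (PiE UNIV ?S)"
    by (simp add: compactin_PiE)
  then have "compact (PiE UNIV ?S)"
    by (simp add: euclidean_product_topology)
  also have "PiE UNIV ?S = {x :: nat \<Rightarrow> real. \<forall>i. \<bar>x i\<bar> \<le> (if i < n then 1 else 0)}"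
    by (auto simp: PiE_UNIV_domain Pi_def abs_le_iff split: if_splits)
       (smt (verit))+
  finally show ?thesis .
qed

text \<open>The form is continuous, so it attains its maximum on the compact unit sphere. Both sides
  of the inequality scale quadratically in \<open>y\<close>, which carries it from unit vectors to
  all \<open>y\<close>.\<close>

lemma quadratic_form_maximizer:
  fixes a :: "nat \<Rightarrow> nat \<Rightarrow> real"
  assumes "0 < n"
  shows "\<exists>x. (\<Sum>i<n. (x i)\<^sup>2) = 1 \<and>
    (\<forall>y. (\<Sum>i<n. \<Sum>j<n. y i * a i j * y j)
          \<le> (\<Sum>i<n. \<Sum>j<n. x i * a i j * x j) * (\<Sum>i<n. (y i)\<^sup>2))"
proof -
  let ?q = "\<lambda>x. \<Sum>i<n. \<Sum>j<n. x i * a i j * x j"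
  let ?N = "\<lambda>x :: nat \<Rightarrow> real. \<Sum>i<n. (x i)\<^sup>2"
  let ?B = "{x :: nat \<Rightarrow> real. \<forall>i. \<bar>x i\<bar> \<le> (if i < n then 1 else 0)}"
  let ?K = "?B \<inter> {x. ?N x = 1}"
  have "closed {x. ?N x = 1}"
    by (intro closed_Collect_eq continuous_intros continuous_on_product_coordinates)
  then have "compact ?K"
    by (intro compact_Int_closed compact_box_fun)
  \<comment> \<open>The first unit vector shows that the sphere is not empty; it needs
    \<open>0 < n\<close>.\<close>
  moreover have "(\<lambda>i. if i = 0 then 1 else 0) \<in> ?K"
    using assms by (auto simp: if_distrib[of "\<lambda>t. t\<^sup>2"] cong: if_cong)
  moreover have "continuous_on ?K ?q"
    by (intro continuous_intros continuous_on_subset[OF continuous_on_product_coordinates]) auto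
  ultimately have "\<exists>x\<in>?K. \<forall>y\<in>?K. ?q y \<le> ?q x"
    by (rule continuous_attains_sup[OF _ ex_in_conv[THEN iffD1, OF exI]])
  then obtain x where x: "x \<in> ?K" and max: "\<And>y. y \<in> ?K \<Longrightarrow> ?q y \<le> ?q x"
    by meson
  have "?q y \<le> ?q x * ?N y" for y
  proof (cases "?N y = 0")
    case True
    then have "\<forall>i<n. y i = 0"
      by (simp add: sum_nonneg_eq_0_iff)
    then show ?thesis by simp
  next
    case False
    define s where "s = sqrt (?N y)"
    have "?N y > 0"
      using False by (simp add: less_le sum_nonneg)
    then have s: "s > 0" "s\<^sup>2 = ?N y" by (auto simp: s_def)
    \<comment> \<open>This is \<open>y\<close> normalized, with the coordinates from
      \<open>n\<close> on cut off so that it lies in \<open>?K\<close>.\<close>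
    define z where "z i = (if i < n then y i / s else 0)" for i
    have "\<bar>y i\<bar> \<le> s" if "i < n" for i
    proof -
      have "(y i)\<^sup>2 \<le> ?N y"
        using that by (intro member_le_sum) auto
      then show ?thesis
        unfolding s_def by (simp add: real_le_rsqrt)
    qed
    moreover have "?N z = ?N y / s\<^sup>2"
      unfolding sum_divide_distrib by (intro sum.cong) (auto simp: z_def power_divide)
    ultimately have zK: "z \<in> ?K"
      using s by (auto simp: z_def)
    have qz: "?q z = ?q y / s\<^sup>2"
      unfolding sum_divide_distrib
      by (intro sum.cong) (auto simp: z_def power2_eq_square)
    have "?q y / s\<^sup>2 \<le> ?q x"
      using max[OF zK] unfolding qz .
    then show ?thesis
      using \<open>?N y > 0\<close> unfolding s(2) by (simp only: pos_divide_le_eq)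
  qed
  with x show ?thesis
    by blast
qed

text \<open>The quadratic has its maximum at \<open>t = 0\<close>, so its derivative
  \<open>b\<close> vanishes there.\<close>

lemma zero_slope_if_quadratic_nonpos:
  fixes b c :: real
  assumes "\<And>t. b * t + c * t\<^sup>2 \<le> 0"
  shows "b = 0"
proof (rule ccontr)
  assume "b \<noteq> 0"
  \<comment> \<open>For small \<open>t\<close> of the sign of \<open>b\<close> the linear term
    dominates; \<open>t = b / d\<close> is small enough because \<open>d + c > 0\<close>.\<close>
  define d where "d = \<bar>c\<bar> + 1"
  have d: "d > 0" "d + c > 0" by (auto simp: d_def)
  have "b * (b / d) + c * (b / d)\<^sup>2 = b\<^sup>2 * (d + c) / d\<^sup>2"
    using d by (simp add: field_simps power2_eq_square)
  moreover have "\<dots> > 0"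
    using d \<open>b \<noteq> 0\<close> by simp
  ultimately show False
    using assms[of "b / d"] by simp
qed

text \<open>The maximizer \<open>x\<close> is an eigenvector: moving it along its residual
  \<open>r = A x - k x\<close> would increase the form beyond \<open>k\<close> times the squared
  norm unless \<open>r = 0\<close>.\<close>

lemma symmetric_mat_Rayleigh_eigenvalue:
  fixes A :: "real mat"
  assumes A: "A \<in> carrier_mat n n" and sym: "\<And>i j. i < n \<Longrightarrow> j < n \<Longrightarrow> A $$ (i, j) = A $$ (j, i)"
    and "0 < n"
  shows "\<exists>k. eigenvalue A k \<and>
    (\<forall>y. (\<Sum>i<n. \<Sum>j<n. y i * A $$ (i, j) * y j) \<le> k * (\<Sum>i<n. (y i)\<^sup>2))"
proof -
  define a where "a i j = A $$ (i, j)" for i j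
  let ?q = "\<lambda>x. \<Sum>i<n. \<Sum>j<n. x i * a i j * x j"
  let ?N = "\<lambda>x :: nat \<Rightarrow> real. \<Sum>i<n. (x i)\<^sup>2"
  obtain x where Nx: "?N x = 1" and max: "\<And>y. ?q y \<le> ?q x * ?N y"
    using quadratic_form_maximizer[OF \<open>0 < n\<close>, of a] by meson
  define k where "k = ?q x"
  define r where "r i = (\<Sum>j<n. a i j * x j) - k * x i" for i
  \<comment> \<open>The left side is \<open>?q - k * ?N\<close> at \<open>x + t r\<close>, which is
    nowhere positive. Its constant term is 0 since \<open>?q x = k\<close> and
    \<open>?N x = 1\<close>; its linear coefficient is twice \<open>r\<close> times
    \<open>A x - k x\<close>, that is, twice the squared norm of \<open>r\<close>.\<close>
  have lin: "2 * (\<Sum>i<n. (r i)\<^sup>2) * t + (?q r - k * ?N r) * t\<^sup>2 \<le> 0" for t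
  proof -
    \<comment> \<open>Symmetry of \<open>A\<close> merges the two mixed terms.\<close>
    have cross: "(\<Sum>i<n. \<Sum>j<n. x i * a i j * r j) = (\<Sum>i<n. \<Sum>j<n. r i * a i j * x j)"
      by (subst sum.swap) (intro sum.cong refl, auto simp: a_def sym)
    have "?q (\<lambda>i. x i + t * r i)
        = ?q x + t * (\<Sum>i<n. \<Sum>j<n. r i * a i j * x j)
          + t * (\<Sum>i<n. \<Sum>j<n. x i * a i j * r j) + t\<^sup>2 * ?q r"
      unfolding sum_distrib_left sum.distrib[symmetric]
      by (intro sum.cong refl) (simp add: algebra_simps power2_eq_square)
    moreover have "?N (\<lambda>i. x i + t * r i) = ?N x + 2 * t * (\<Sum>i<n. x i * r i) + t\<^sup>2 * ?N r"
      unfolding sum_distrib_left sum.distrib[symmetric]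
      by (intro sum.cong refl) (simp add: algebra_simps power2_eq_square)
    moreover have "(\<Sum>i<n. \<Sum>j<n. r i * a i j * x j) = (\<Sum>i<n. (r i)\<^sup>2) + k * (\<Sum>i<n. x i * r i)"
    proof -
      have "(\<Sum>j<n. r i * a i j * x j) = (r i)\<^sup>2 + k * (x i * r i)" for i
      proof -
        have "(\<Sum>j<n. r i * a i j * x j) = r i * (r i + k * x i)"
          by (simp add: r_def sum_distrib_left mult.assoc)
        then show ?thesis by (simp add: algebra_simps power2_eq_square)
      qed
      then show ?thesis
        by (simp add: sum.distrib sum_distrib_left)
    qed
    moreover have "?q (\<lambda>i. x i + t * r i) \<le> k * ?N (\<lambda>i. x i + t * r i)"
      using max unfolding k_def .
    ultimately show ?thesis
      using Nx cross unfolding k_def[symmetric] by (simp add: algebra_simps)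
  qed
  have "(\<Sum>i<n. (r i)\<^sup>2) = 0"
    using zero_slope_if_quadratic_nonpos[OF lin] by simp
  then have r0: "r i = 0" if "i < n" for i
    using that by (simp add: sum_nonneg_eq_0_iff)
  have "A *\<^sub>v vec n x = k \<cdot>\<^sub>v vec n x"
  proof (rule eq_vecI)
    fix i assume "i < dim_vec (k \<cdot>\<^sub>v vec n x)"
    then have i: "i < n" by simp
    then have "vec_index (A *\<^sub>v vec n x) i = (\<Sum>j<n. a i j * x j)"
      using A by (auto simp: scalar_prod_def a_def lessThan_atLeast0 intro!: sum.cong)
    also have "\<dots> = vec_index (k \<cdot>\<^sub>v vec n x) i"
      using r0[OF i] i by (simp add: r_def)
    finally show "vec_index (A *\<^sub>v vec n x) i = vec_index (k \<cdot>\<^sub>v vec n x) i" .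
  qed (use A in simp)
  moreover have "vec n x \<noteq> 0\<^sub>v n"
  proof
    assume "vec n x = 0\<^sub>v n"
    then have "x i = 0" if "i < n" for i
      using that by (metis index_vec index_zero_vec(1))
    with Nx show False by simp
  qed
  ultimately have "eigenvector A (vec n x) k"
    using A by (simp add: eigenvector_def)
  then have "eigenvalue A k"
    unfolding eigenvalue_def by blast
  moreover have "\<forall>y. ?q y \<le> k * ?N y"
    using max unfolding k_def by blast
  ultimately show ?thesis
    unfolding a_def by blast
qed

lemma average_row_sum_le_largest_eigenvalue:
  fixes A :: "real mat"
  assumes A: "A \<in> carrier_mat n n" and sym: "\<And>i j. i < n \<Longrightarrow> j < n \<Longrightarrow> A $$ (i, j) = A $$ (j, i)"
    and "0 < n"
  shows "(\<Sum>i<n. \<Sum>j<n. A $$ (i, j)) / n \<le> largest_eigenvalue A"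
proof -
  obtain k where k: "eigenvalue A k"
    and le: "\<And>y. (\<Sum>i<n. \<Sum>j<n. y i * A $$ (i, j) * y j) \<le> k * (\<Sum>i<n. (y i)\<^sup>2)"
    using symmetric_mat_Rayleigh_eigenvalue[OF assms] by meson
  \<comment> \<open>The spectrum is finite, so \<open>Max\<close> bounds each of its
    members.\<close>
  have "k \<le> largest_eigenvalue A"
    unfolding largest_eigenvalue_def
    using k card_finite_spectrum(1)[OF A] by (intro Max_ge) (auto simp: spectrum_def)
  moreover have "(\<Sum>i<n. \<Sum>j<n. A $$ (i, j)) / n \<le> k"
    using le[of "\<lambda>_. 1"] \<open>0 < n\<close> by (simp add: divide_le_eq)
  ultimately show ?thesis by linarith
qed

section \<open>Distances as least walk lengths\<close>

lemma (in pair_wf_digraph) awalk_cost_one: "awalk_cost (\<lambda>_. 1) p = length p"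
  by (simp add: awalk_cost_def sum_list_triv)

text \<open>Reachability keeps the infimum finite; an infinite one would be turned into 0 by
  \<open>real_of_ereal\<close> and the bound could fail.\<close>

lemma (in pair_wf_digraph) le_graph_dist:
  assumes "u \<rightarrow>\<^sup>*\<^bsub>with_proj G\<^esub> v" and "\<And>p. awalk u p v \<Longrightarrow> n \<le> length p"
  shows "real n \<le> graph_dist G u v"
proof -
  obtain p where "awalk u p v"
    using assms(1) by (auto simp: reachable_awalk)
  then have "\<mu> (\<lambda>_. 1) u v \<le> ereal (length p)"
    using min_cost_le_walk_cost[of u p v "\<lambda>_. 1"] by (simp add: awalk_cost_one)
  moreover have "ereal (real n) \<le> \<mu> (\<lambda>_. 1) u v"
    unfolding \<mu>_def using assms(2) by (intro INF_greatest) (auto simp: awalk_cost_one)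
  ultimately show ?thesis
    unfolding graph_dist_def by (cases "\<mu> (\<lambda>_. 1) u v") auto
qed

text \<open>Reversing a walk preserves its length.\<close>

lemma (in pair_sym_digraph) graph_dist_commute: "graph_dist G u v = graph_dist G v u"
proof -
  have "\<mu> (\<lambda>_. 1) v u \<le> \<mu> (\<lambda>_. 1) u v" for u v
    unfolding \<mu>_def
  proof (rule INF_mono)
    fix p assume "p \<in> {p. awalk u p v}"
    then have "awalk v (rev_path p) u"
      by (simp add: awalk_rev_path')
    moreover have "length (rev_path p) = length p"
      by (induct p) auto
    ultimately show "\<exists>q\<in>{q. awalk v q u}.
        ereal (awalk_cost (\<lambda>_. 1) q) \<le> ereal (awalk_cost (\<lambda>_. 1) p)"
      by (auto simp: awalk_cost_one intro!: exI[of _ "rev_path p"])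
  qed
  then show ?thesis
    unfolding graph_dist_def by (metis order_antisym)
qed

section \<open>Distances and transmissions in the line graph\<close>

lemma line_graph_simps [simp]:
  "pverts (line_graph G) = edges G"
  "parcs (line_graph G) = {(e, f). e \<in> edges G \<and> f \<in> edges G \<and> adjacent_edges e f}"
  by (auto simp: line_graph_def)

text \<open>Consecutive edges of a walk in \<open>G\<close> share a vertex, so the walk lifts to the
  line graph.\<close>

lemma line_graph_reachable:
  assumes "pair_graph G" and "Digraph_Component.connected (with_proj G)"
    and "e \<in> edges G" and "f \<in> edges G"
  shows "e \<rightarrow>\<^sup>*\<^bsub>with_proj (line_graph G)\<^esub> f"
proof -
  interpret pair_graph G by fact
  interpret L: pair_graph "line_graph G"
    using assms(1) by (rule pair_graph_line_graph)
  have share: "e \<rightarrow>\<^sup>*\<^bsub>with_proj (line_graph G)\<^esub> f"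
    if "e \<in> edges G" "f \<in> edges G" "u \<in> e" "u \<in> f" for e f u
  proof (cases "e = f")
    case True
    then show ?thesis using that by simp
  next
    case False
    then show ?thesis
      using that by (intro L.reachable_adjI) (auto simp: adjacent_edges_def)
  qed
  obtain u v w z where e: "e = {u, v}" "(u, v) \<in> parcs G" and f: "f = {w, z}" "(w, z) \<in> parcs G"
    using assms(3,4) by (auto simp: edges_def)
  have "strongly_connected (with_proj G)"
    using symmetric_connected_imp_strongly_connected pair_sym_arcs assms(2) by blast
  then have "u \<rightarrow>\<^sup>*\<^bsub>with_proj G\<^esub> w"
    using e f by (auto simp: strongly_connected_def dest: in_arcsD1)
  \<comment> \<open>Quantifying over all edges at the current vertex makes the induction work: an
    edge at \<open>x\<close> meets \<open>{x, y}\<close> in \<open>x\<close>, and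
    \<open>{x, y}\<close> is an edge at \<open>y\<close>, covered by the induction
    hypothesis.\<close>
  then have "\<forall>e\<in>edges G. u \<in> e \<longrightarrow> e \<rightarrow>\<^sup>*\<^bsub>with_proj (line_graph G)\<^esub> f"
  proof (induct rule: converse_reachable_induct)
    case base
    then show ?case
      using share assms(4) f by auto
  next
    case (step x y)
    then have "{x, y} \<in> edges G"
      by (auto simp: edges_def)
    then show ?case
      using step(3) share
      by (meson L.reachable_trans insertI1 insertI2)
  qed
  then show ?thesis
    using assms(3) e by auto
qed

lemma line_graph_dist_ge:
  assumes "pair_graph G" and "Digraph_Component.connected (with_proj G)"
    and "e \<in> edges G" and "f \<in> edges G" and "e \<noteq> f"
  shows "2 - of_bool (adjacent_edges e f) \<le> graph_dist (line_graph G) e f"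
proof -
  interpret L: pair_graph "line_graph G"
    using assms(1) by (rule pair_graph_line_graph)
  have reach: "e \<rightarrow>\<^sup>*\<^bsub>with_proj (line_graph G)\<^esub> f"
    using assms by (intro line_graph_reachable)
  have "2 - of_bool (adjacent_edges e f) \<le> length p" if "L.awalk e p f" for p
    \<comment> \<open>The rule splits \<open>p\<close> into no arc, impossible as
      \<open>e \<noteq> f\<close>; one arc, which forces adjacency; and at least two arcs.\<close>
    using that \<open>e \<noteq> f\<close> by (cases p rule: remdups_adj.cases) (auto simp: L.awalk_simps)
  from L.le_graph_dist[OF reach this] show ?thesis
    by (auto split: if_splits)
qed

lemma line_graph_transmission_ge:
  assumes "pair_graph G" and "Digraph_Component.connected (with_proj G)"
    and "e \<in> edges G"
  shows "2 * (real (card (edges G)) - 1) - real (edge_degree G e) \<le> transmission (line_graph G) e"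
proof -
  interpret L: pair_graph "line_graph G"
    using assms(1) by (rule pair_graph_line_graph)
  let ?d = "graph_dist (line_graph G) e"
  have fin: "finite (edges G)"
    using L.pair_finite_verts by simp
  \<comment> \<open>No edge is adjacent to itself, so leaving out \<open>e\<close> does not change
    the degree.\<close>
  have "{f \<in> edges G - {e}. adjacent_edges e f} = {f \<in> edges G. adjacent_edges e f}"
    by (auto simp: adjacent_edges_def)
  then have deg: "(\<Sum>f\<in>edges G - {e}. of_bool (adjacent_edges e f)) = real (edge_degree G e)"
    using fin by (simp add: edge_degree_def Int_def)
  have "card (edges G) \<ge> 1"
    using fin assms(3) by (metis One_nat_def Suc_leI card_gt_0_iff empty_iff)
  then have "2 * (real (card (edges G)) - 1) - real (edge_degree G e)
      = (\<Sum>f\<in>edges G - {e}. 2 - of_bool (adjacent_edges e f))"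
    using assms(3) by (simp add: sum_subtractf deg of_nat_diff)
  also have "\<dots> \<le> (\<Sum>f\<in>edges G - {e}. ?d f)"
    using assms by (intro sum_mono line_graph_dist_ge) auto
  \<comment> \<open>The distance from \<open>e\<close> to itself is nonnegative.\<close>
  also have "\<dots> \<le> ?d e + (\<Sum>f\<in>edges G - {e}. ?d f)"
    using L.le_graph_dist[of e e 0] assms(3) by simp
  also have "\<dots> = transmission (line_graph G) e"
    using sum.remove[OF fin assms(3), of ?d] by (simp add: transmission_def)
  finally show ?thesis .
qed

section \<open>Row sums of the generalized distance matrix and the bound on its largest
  eigenvalue\<close>

text \<open>The diagonal part contributes \<alpha> times the transmission and the distances
  contribute 1 - \<alpha> times it, so \<alpha> cancels.\<close>

lemma gen_distance_matrix_row_sum: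
  assumes "distinct vs" and "set vs = pverts H" and "i < length vs"
  shows "(\<Sum>j<length vs. gen_distance_matrix \<alpha> H vs $$ (i, j)) = transmission H (vs ! i)"
proof -
  let ?n = "length vs" and ?T = "transmission H (vs ! i)"
  have "(\<Sum>j<?n. graph_dist H (vs ! i) (vs ! j)) = ?T"
    unfolding transmission_def
    using sum.reindex_bij_betw[OF bij_betw_nth[OF assms(1) refl assms(2)[symmetric]]] .
  moreover have "(\<Sum>j<?n. gen_distance_matrix \<alpha> H vs $$ (i, j))
      = (\<Sum>j<?n. (if j = i then \<alpha> * ?T else 0) + (1 - \<alpha>) * graph_dist H (vs ! i) (vs ! j))"
    using assms(3)
    by (intro sum.cong refl)
       (auto simp: gen_distance_matrix_def transmission_matrix_def distance_matrix_def mat_diag_def)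
  ultimately show ?thesis
    using assms(3) unfolding sum.distrib sum_distrib_left[symmetric]
    by (simp add: algebra_simps)
qed

theorem theorem4p11:
  fixes G :: "'a pair_pre_digraph" and es :: "'a set list" and m :: nat and \<alpha> :: real
  assumes "pair_graph G"
    and "Digraph_Component.connected (with_proj G)"
    and "distinct es" and "set es = edges G" and "length es = m"
    and "m \<ge> 1"
    and "0 \<le> \<alpha>" and "\<alpha> \<le> 1"
  shows "gen_distance_rho \<alpha> (line_graph G) es
           \<ge> 2 * (real m - 1) - 1 / real m * (\<Sum>i<m. real (edge_degree G (es ! i)))"
proof -
  interpret L: pair_graph "line_graph G"
    using assms(1) by (rule pair_graph_line_graph)
  let ?A = "gen_distance_matrix \<alpha> (line_graph G) es"
  have card: "card (edges G) = m"
    using assms distinct_card by metis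
  have A: "?A \<in> carrier_mat m m"
    using assms(5)
    by (simp add: gen_distance_matrix_def transmission_matrix_def distance_matrix_def mat_diag_def)
  have sym: "?A $$ (i, j) = ?A $$ (j, i)" if "i < m" "j < m" for i j
    using that assms(5) L.graph_dist_commute[of "es ! i" "es ! j"]
    by (auto simp: gen_distance_matrix_def transmission_matrix_def distance_matrix_def mat_diag_def)
  \<comment> \<open>The bound is the average over all edges of the bounds on their
    transmissions.\<close>
  have "2 * (real m - 1) - 1 / real m * (\<Sum>i<m. real (edge_degree G (es ! i)))
      = (\<Sum>i<m. 2 * (real m - 1) - real (edge_degree G (es ! i))) / m"
    using assms(6) by (simp add: sum_subtractf field_simps)
  also have "\<dots> \<le> (\<Sum>i<m. transmission (line_graph G) (es ! i)) / m"
    using line_graph_transmission_ge[OF assms(1,2), unfolded card] nth_mem[of _ es] assms(4,5)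
    by (intro divide_right_mono sum_mono) auto
  also have "\<dots> = (\<Sum>i<m. \<Sum>j<m. ?A $$ (i, j)) / m"
    using gen_distance_matrix_row_sum[of es "line_graph G"] assms(3-5) by simp
  also have "\<dots> \<le> gen_distance_rho \<alpha> (line_graph G) es"
    unfolding gen_distance_rho_def
    using assms(6) by (intro average_row_sum_le_largest_eigenvalue A sym) auto
  finally show ?thesis .
qed

end
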